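(* Let $M$ be a pseudomeadow with finitely many idempotents. Then: (a) $M$ has a multiplicative identity element, and it is equal to the sum of all minimal idempotents of $M$. (b) If $\{e_1,\dots,e_n\}$ is the set of all (distinct) minimal idempotents of $M$, then $M\cong Me_1\times\cdots\times Me_n$.
   Context: A pseudoring is a commutative associative ring that is not required to have a multiplicative identity. A pseudomeadow is a pseudoring $R$ in which every $x\in R$ has a von Neumann inverse, i.e. an element $x^{(-1)}\in R$ (necessarily unique) with $x\,x\,x^{(-1)}=x$ and $x\,x^{(-1)}x^{(-1)}=x^{(-1)}$. An idempotent is an element $e$ with $e^2=e$. Idempotents are partially ordered by $e\le f$ iff $ef=e$. A minimal idempotent is an idempotent $e\neq 0$ such that for every non-zero idempotent $f$, $f\le e$ implies $f=e$. For an idempotent $e$, $Me=\{xe: x\in M\}$, with the operations induced from $M$; when $e$ is a minimal idempotent of a pseudomeadow, $Me$ is a field with identity element $e$. Isomorphism means a bijective map preserving addition and multiplication. Conventions: the empty sum is $0$ and the empty product is the zero ring (this covers $M=\{0\}$, $n=0$). *)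

theory Defs
  imports "HOL-Algebra.Algebra"
begin

text \<open>
  A pseudoring is represented by the ring record of HOL-Algebra. Its field \<open>one\<close> is
  unconstrained and plays no role in the definitions below.
\<close>

locale pseudoring = abelian_group R for R (structure) +
  assumes mult_closed: "x \<in> carrier R \<Longrightarrow> y \<in> carrier R \<Longrightarrow> x \<otimes> y \<in> carrier R"
    and mult_assoc: "x \<in> carrier R \<Longrightarrow> y \<in> carrier R \<Longrightarrow> z \<in> carrier R
      \<Longrightarrow> (x \<otimes> y) \<otimes> z = x \<otimes> (y \<otimes> z)"
    and mult_comm: "x \<in> carrier R \<Longrightarrow> y \<in> carrier R \<Longrightarrow> x \<otimes> y = y \<otimes> x"
    and mult_distrib: "x \<in> carrier R \<Longrightarrow> y \<in> carrier R \<Longrightarrow> z \<in> carrier R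
      \<Longrightarrow> (x \<oplus> y) \<otimes> z = x \<otimes> z \<oplus> y \<otimes> z"

locale pseudomeadow = pseudoring M for M (structure) +
  assumes von_Neumann_inverse:
    "x \<in> carrier M \<Longrightarrow> \<exists>y \<in> carrier M. x \<otimes> x \<otimes> y = x \<and> x \<otimes> y \<otimes> y = y"

definition idempotents :: "('a, 'm) ring_scheme \<Rightarrow> 'a set"
  where "idempotents R = {e \<in> carrier R. e \<otimes>\<^bsub>R\<^esub> e = e}"

definition idem_le :: "('a, 'm) ring_scheme \<Rightarrow> 'a \<Rightarrow> 'a \<Rightarrow> bool"
  where "idem_le R e f \<longleftrightarrow> e \<otimes>\<^bsub>R\<^esub> f = e"

definition minimal_idempotents :: "('a, 'm) ring_scheme \<Rightarrow> 'a set"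
  where "minimal_idempotents R =
    {e \<in> idempotents R. e \<noteq> \<zero>\<^bsub>R\<^esub> \<and>
       (\<forall>f \<in> idempotents R. f \<noteq> \<zero>\<^bsub>R\<^esub> \<longrightarrow> idem_le R f e \<longrightarrow> f = e)}"

definition is_mult_identity :: "('a, 'm) ring_scheme \<Rightarrow> 'a \<Rightarrow> bool"
  where "is_mult_identity R u \<longleftrightarrow>
    u \<in> carrier R \<and> (\<forall>x \<in> carrier R. u \<otimes>\<^bsub>R\<^esub> x = x \<and> x \<otimes>\<^bsub>R\<^esub> u = x)"

text \<open>
  The ring \<open>Re = {xe : x \<in> R}\<close> with the operations of \<open>R\<close>. Setting the field \<open>one\<close> to
  \<open>e\<close> lets the ring locales of HOL-Algebra apply to it.
\<close>

definition corner :: "('a, 'm) ring_scheme \<Rightarrow> 'a \<Rightarrow> ('a, 'm) ring_scheme"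
  where "corner R e = R\<lparr>carrier := {x \<otimes>\<^bsub>R\<^esub> e | x. x \<in> carrier R}, one := e\<rparr>"

text \<open>
  Isomorphism of pseudorings. In contrast to \<^const>\<open>ring_iso\<close>, nothing is required of the
  field \<open>one\<close>, which has no meaning in a pseudoring.
\<close>

definition pseudoring_iso ::
    "('a, 'm) ring_scheme \<Rightarrow> ('b, 'n) ring_scheme \<Rightarrow> ('a \<Rightarrow> 'b) set"
  where "pseudoring_iso R S =
    {h. bij_betw h (carrier R) (carrier S) \<and>
        (\<forall>x \<in> carrier R. \<forall>y \<in> carrier R.
           h (x \<oplus>\<^bsub>R\<^esub> y) = h x \<oplus>\<^bsub>S\<^esub> h y \<and> h (x \<otimes>\<^bsub>R\<^esub> y) = h x \<otimes>\<^bsub>S\<^esub> h y)}"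

definition pseudoring_isomorphic ::
    "('a, 'm) ring_scheme \<Rightarrow> ('b, 'n) ring_scheme \<Rightarrow> bool"
  where "pseudoring_isomorphic R S \<longleftrightarrow> pseudoring_iso R S \<noteq> {}"

end

theory Submission
  imports Defs
begin

text \<open>
  Let \<open>u\<close> be the sum of the minimal idempotents. These are pairwise orthogonal, so \<open>e u = e\<close> for
  each of them, and hence \<open>z = x - u x\<close> is annihilated by every minimal idempotent. If \<open>z\<close> were
  non-zero, \<open>f = z z'\<close> with \<open>z'\<close> the von Neumann inverse of \<open>z\<close> would be a non-zero idempotent; by
  finiteness there is a minimal idempotent \<open>e\<close> below \<open>f\<close>, and then \<open>e = e f = (e z) z' = 0\<close>.
  So \<open>u\<close> is the identity, and \<open>x \<mapsto> (x e\<^sub>1, \<dots>, x e\<^sub>n)\<close> is an isomorphism whose inverse is summation.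
\<close>

section \<open>Componentwise operations in finite products\<close>

lemma mult_RDirProd_list_map:
  assumes "\<And>i. i \<in> set is \<Longrightarrow> f i \<in> carrier (R i)" "\<And>i. i \<in> set is \<Longrightarrow> g i \<in> carrier (R i)"
  shows "map f is \<otimes>\<^bsub>RDirProd_list (map R is)\<^esub> map g is = map (\<lambda>i. f i \<otimes>\<^bsub>R i\<^esub> g i) is"
  using assms
proof (induction "is")
  case Nil
  show ?case by (simp add: monoid.defs)
next
  case (Cons i "is")
  let ?P = "RDirProd_list (map R is)"
  \<comment> \<open>\<open>RDirProd_list_hom1\<close> makes prepending a component a homomorphism
    from the binary product. Its laws hold on the carrier, so both pairs must be shown to lie there;
    no ring axioms for the factors enter.\<close>
  have mem: "(f i, map f is) \<in> carrier (RDirProd (R i) ?P)" "(g i, map g is) \<in> carrier (RDirProd (R i) ?P)"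
    using Cons.prems by (auto simp: RDirProd_carrier intro!: RDirProd_list_carrier_memI)
  show ?case
    using ring_hom_mult[OF RDirProd_list_hom1 mem] Cons
    by (simp add: RDirProd_def DirProd_def monoid.defs)
qed

lemma add_RDirProd_list_map:
  assumes "\<And>i. i \<in> set is \<Longrightarrow> f i \<in> carrier (R i)" "\<And>i. i \<in> set is \<Longrightarrow> g i \<in> carrier (R i)"
  shows "map f is \<oplus>\<^bsub>RDirProd_list (map R is)\<^esub> map g is = map (\<lambda>i. f i \<oplus>\<^bsub>R i\<^esub> g i) is"
  using assms
proof (induction "is")
  case Nil
  show ?case by (simp add: monoid.defs)
next
  case (Cons i "is")
  let ?P = "RDirProd_list (map R is)"
  have mem: "(f i, map f is) \<in> carrier (RDirProd (R i) ?P)" "(g i, map g is) \<in> carrier (RDirProd (R i) ?P)"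
    using Cons.prems by (auto simp: RDirProd_carrier intro!: RDirProd_list_carrier_memI)
  show ?case
    using ring_hom_add[OF RDirProd_list_hom1 mem] Cons
    by (simp add: RDirProd_def DirProd_def monoid.defs)
qed

lemma corner_simps [simp]:
  "carrier (corner R e) = {x \<otimes>\<^bsub>R\<^esub> e | x. x \<in> carrier R}"
  "monoid.mult (corner R e) = monoid.mult R"
  "add (corner R e) = add R"
  by (simp_all add: corner_def)

lemma idempotentsD:
  assumes "e \<in> idempotents R"
  shows "e \<in> carrier R" "e \<otimes>\<^bsub>R\<^esub> e = e"
  using assms by (simp_all add: idempotents_def)

lemma minimal_idempotents_subset: "minimal_idempotents R \<subseteq> idempotents R"
  by (auto simp: minimal_idempotents_def)

lemma minimal_idempotentsD:
  assumes "e \<in> minimal_idempotents R"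
  shows "e \<in> carrier R" "e \<otimes>\<^bsub>R\<^esub> e = e" "e \<noteq> \<zero>\<^bsub>R\<^esub>"
  using assms by (auto simp: minimal_idempotents_def idempotents_def)

section \<open>Arithmetic without an identity element\<close>

context pseudoring
begin

declare mult_closed [simp, intro]

lemma mult_lcomm:
  "x \<in> carrier R \<Longrightarrow> y \<in> carrier R \<Longrightarrow> z \<in> carrier R \<Longrightarrow> x \<otimes> (y \<otimes> z) = y \<otimes> (x \<otimes> z)"
  by (metis mult_assoc mult_comm)

lemmas mult_ac = mult_assoc mult_comm mult_lcomm

lemma zero_mult [simp]:
  assumes "x \<in> carrier R"
  shows "\<zero> \<otimes> x = \<zero>"
proof -
  have "\<zero> \<otimes> x \<oplus> \<zero> \<otimes> x = \<zero> \<otimes> x"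
    using assms mult_distrib[of \<zero> \<zero> x] by simp
  then show ?thesis
    using assms add.l_cancel_one by auto
qed

lemma mult_zero [simp]: "x \<in> carrier R \<Longrightarrow> x \<otimes> \<zero> = \<zero>"
  by (metis mult_comm zero_closed zero_mult)

lemma minus_mult:
  assumes "x \<in> carrier R" "y \<in> carrier R" "z \<in> carrier R"
  shows "(x \<ominus> y) \<otimes> z = x \<otimes> z \<ominus> y \<otimes> z"
proof -
  have "(\<ominus> y) \<otimes> z \<oplus> y \<otimes> z = \<zero>"
    using assms mult_distrib[of "\<ominus> y" y z] by (simp add: l_neg)
  then have "\<ominus> (y \<otimes> z) = (\<ominus> y) \<otimes> z"
    using assms by (intro minus_equality) auto
  then show ?thesis
    using assms mult_distrib[of x "\<ominus> y" z] by (simp add: a_minus_def)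
qed

lemma finsum_mult:
  assumes "finite A" "a \<in> carrier R" "f \<in> A \<rightarrow> carrier R"
  shows "(\<Oplus>i\<in>A. f i) \<otimes> a = (\<Oplus>i\<in>A. f i \<otimes> a)"
  using assms by (induction rule: finite_induct) (auto simp: mult_distrib Pi_iff)

text \<open>Distributing \<open>e\<close> over the sum kills every term but the one at
  \<open>j\<close>. This serves both to show that the sum of the minimal idempotents fixes each of
  them and to read off the components of a sum.\<close>

lemma finsum_mult_orthogonal:
  assumes "finite A" "j \<in> A" "f \<in> A \<rightarrow> carrier R" "e \<in> carrier R"
    and "\<And>i. i \<in> A \<Longrightarrow> i \<noteq> j \<Longrightarrow> f i \<otimes> e = \<zero>"
  shows "(\<Oplus>i\<in>A. f i) \<otimes> e = f j \<otimes> e"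
proof -
  have "(\<Oplus>i\<in>A. f i) \<otimes> e = (\<Oplus>i\<in>A. f i \<otimes> e)"
    using assms by (intro finsum_mult)
  also have "\<dots> = (\<Oplus>i\<in>A. if j = i then f i \<otimes> e else \<zero>)"
    using assms by (intro finsum_cong') (auto simp: Pi_iff)
  also have "\<dots> = f j \<otimes> e"
    using assms by (intro finsum_singleton) auto
  finally show ?thesis .
qed

section \<open>Order and orthogonality of idempotents\<close>

lemma idempotents_mult:
  assumes "e \<in> idempotents R" "f \<in> idempotents R"
  shows "e \<otimes> f \<in> idempotents R"
proof -
  note ef = idempotentsD[OF assms(1)] idempotentsD[OF assms(2)]
  have "(e \<otimes> f) \<otimes> (e \<otimes> f) = (e \<otimes> e) \<otimes> (f \<otimes> f)"
    using ef(1,3) by (simp add: mult_ac)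
  then show ?thesis
    using ef by (simp add: idempotents_def)
qed

text \<open>The product \<open>e \<otimes> f\<close> is an idempotent below both factors. If it were
  non-zero, minimality would make it equal to \<open>e\<close> and to \<open>f\<close>.\<close>

lemma minimal_idempotents_orthogonal:
  assumes "e \<in> minimal_idempotents R" "f \<in> minimal_idempotents R" "e \<noteq> f"
  shows "e \<otimes> f = \<zero>"
proof (rule ccontr)
  assume nz: "e \<otimes> f \<noteq> \<zero>"
  note e = minimal_idempotentsD[OF assms(1)] and f = minimal_idempotentsD[OF assms(2)]
  have ef: "e \<in> idempotents R" "f \<in> idempotents R"
    using assms(1,2) by (simp_all add: minimal_idempotents_def)
  have idem: "e \<otimes> f \<in> idempotents R"
    by (rule idempotents_mult[OF ef])
  have "idem_le R (e \<otimes> f) f"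
    using e f by (simp add: idem_le_def mult_assoc)
  moreover have "idem_le R (e \<otimes> f) e"
    using mult_comm[OF e(1) f(1)] e f by (simp add: idem_le_def mult_assoc)
  ultimately have "e \<otimes> f = e" "e \<otimes> f = f"
    using assms idem nz by (auto simp: minimal_idempotents_def)
  with \<open>e \<noteq> f\<close> show False by simp
qed

lemma idem_le_trans:
  assumes "idem_le R e f" "idem_le R f g" "e \<in> carrier R" "f \<in> carrier R" "g \<in> carrier R"
  shows "idem_le R e g"
  using assms unfolding idem_le_def by (metis mult_assoc)

lemma idem_le_antisym:
  assumes "idem_le R e f" "idem_le R f e" "e \<in> carrier R" "f \<in> carrier R"
  shows "e = f"
  using assms unfolding idem_le_def by (metis mult_comm)

text \<open>Descent: a non-minimal \<open>f\<close> has a non-zero idempotent \<open>g\<close>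
  strictly below it, and the number of idempotents below \<open>g\<close> is smaller than the number
  below \<open>f\<close>.\<close>

lemma ex_minimal_idempotent_le:
  assumes "finite (idempotents R)" "f \<in> idempotents R" "f \<noteq> \<zero>"
  shows "\<exists>e\<in>minimal_idempotents R. idem_le R e f"
  using assms(2,3)
proof (induction "card {g \<in> idempotents R. idem_le R g f}" arbitrary: f rule: less_induct)
  case less
  show ?case
  proof (cases "f \<in> minimal_idempotents R")
    case True
    then show ?thesis
      by (auto simp: idem_le_def dest: minimal_idempotentsD)
  next
    case False
    then obtain g where g: "g \<in> idempotents R" "g \<noteq> \<zero>" "idem_le R g f" "g \<noteq> f"
      using less.prems by (auto simp: minimal_idempotents_def)
    note car = idempotentsD(1)[OF less.prems(1)] idempotentsD(1)[OF g(1)]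
    \<comment> \<open>The down-set of \<open>g\<close> lies in that of \<open>f\<close> by
      transitivity; \<open>f\<close> itself witnesses that the inclusion is strict.\<close>
    have "f \<notin> {h \<in> idempotents R. idem_le R h g}"
      using g(3,4) car idem_le_antisym[of g f] by auto
    moreover have "f \<in> {h \<in> idempotents R. idem_le R h f}"
      using less.prems by (simp add: idem_le_def idempotentsD)
    moreover have "{h \<in> idempotents R. idem_le R h g} \<subseteq> {h \<in> idempotents R. idem_le R h f}"
      using idem_le_trans[OF _ g(3) _ car(2,1)] by (auto dest: idempotentsD(1))
    ultimately have "card {h \<in> idempotents R. idem_le R h g} < card {h \<in> idempotents R. idem_le R h f}"
      using assms(1) by (intro psubset_card_mono) auto
    then obtain e where e: "e \<in> minimal_idempotents R" "idem_le R e g"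
      using less.hyps g by blast
    then have "idem_le R e f"
      using idem_le_trans[OF e(2) g(3) minimal_idempotentsD(1)[OF e(1)] car(2,1)] by simp
    with e(1) show ?thesis by blast
  qed
qed

text \<open>Peirce decomposition along a complete system of orthogonal idempotents: orthogonality
  gives surjectivity, completeness gives injectivity. For \<open>es = []\<close> the identity is the
  empty sum \<zero>, so \<open>R\<close> is the zero ring, matching the empty product.\<close>

lemma isomorphic_RDirProd_list_corner:
  assumes "distinct es" "set es \<subseteq> idempotents R"
    and orth: "\<And>e f. e \<in> set es \<Longrightarrow> f \<in> set es \<Longrightarrow> e \<noteq> f \<Longrightarrow> e \<otimes> f = \<zero>"
    and one: "is_mult_identity R (\<Oplus>e\<in>set es. e)"
  shows "pseudoring_isomorphic R (RDirProd_list (map (corner R) es))"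
proof -
  let ?P = "RDirProd_list (map (corner R) es)" and ?h = "\<lambda>x. map (\<lambda>e. x \<otimes> e) es"
  have car: "e \<in> carrier R" and idem: "e \<otimes> e = e" if "e \<in> set es" for e
    using idempotentsD[OF subsetD[OF assms(2) that]] by simp_all
  have closed: "?h x \<in> carrier ?P" if "x \<in> carrier R" for x
    using that by (intro RDirProd_list_carrier_memI) auto
  \<comment> \<open>Multiplying the decomposition of the identity by \<open>x\<close> recovers
    \<open>x\<close> from its components, whence injectivity.\<close>
  have expand: "x = (\<Oplus>e\<in>set es. x \<otimes> e)" if "x \<in> carrier R" for x
  proof -
    have "x = (\<Oplus>e\<in>set es. e) \<otimes> x"
      using one that by (simp add: is_mult_identity_def)
    also have "\<dots> = (\<Oplus>e\<in>set es. e \<otimes> x)"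
      using that car by (intro finsum_mult) auto
    also have "\<dots> = (\<Oplus>e\<in>set es. x \<otimes> e)"
      using that car by (intro finsum_cong') (auto simp: mult_comm)
    finally show ?thesis .
  qed
  have inj: "inj_on ?h (carrier R)"
  proof (rule inj_onI)
    fix x y assume xy: "x \<in> carrier R" "y \<in> carrier R" "?h x = ?h y"
    have "(\<Oplus>e\<in>set es. x \<otimes> e) = (\<Oplus>e\<in>set es. y \<otimes> e)"
      using xy car by (intro finsum_cong') auto
    then show "x = y"
      using expand xy by simp
  qed
  have surj: "as \<in> ?h ` carrier R" if "as \<in> carrier ?P" for as
  proof
    have len: "length as = length es"
      using RDirProd_list_carrier_mem(1)[OF that] by simp
    have "\<exists>y\<in>carrier R. as ! i = y \<otimes> es ! i" if "i < length es" for i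
      using RDirProd_list_carrier_mem(2)[OF \<open>as \<in> carrier ?P\<close>, of i] that by auto
    then obtain y where y: "\<And>i. i < length es \<Longrightarrow> y i \<in> carrier R \<and> as ! i = y i \<otimes> es ! i"
      by metis
    have as_car: "(\<lambda>i. as ! i) \<in> {..<length es} \<rightarrow> carrier R"
      using y car by auto
    \<comment> \<open>The preimage is the sum of the entries. It runs over positions because
      different entries may be equal, for instance both \<zero>.\<close>
    let ?x = "\<Oplus>i\<in>{..<length es}. as ! i"
    show "?x \<in> carrier R"
      using as_car by (rule finsum_closed)
    have "?x \<otimes> es ! j = as ! j" if "j < length es" for j
    proof -
      have "as ! i \<otimes> es ! j = \<zero>" if "i < length es" "i \<noteq> j" for i
      proof -
        \<comment> \<open>Distinctness of the list turns different positions into different, hence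
          orthogonal, idempotents.\<close>
        have "es ! i \<noteq> es ! j"
          using that \<open>j < length es\<close> assms(1) by (simp add: nth_eq_iff_index_eq)
        then show ?thesis
          using that \<open>j < length es\<close> y car orth by (simp add: mult_assoc)
      qed
      then have "?x \<otimes> es ! j = as ! j \<otimes> es ! j"
        using that as_car car by (intro finsum_mult_orthogonal) auto
      then show ?thesis
        using that y car idem by (simp add: mult_assoc)
    qed
    then show "as = ?h ?x"
      using len by (auto intro!: nth_equalityI)
  qed
  have "bij_betw ?h (carrier R) (carrier ?P)"
    using inj surj closed by (auto simp: bij_betw_def)
  moreover have "?h (x \<oplus> y) = ?h x \<oplus>\<^bsub>?P\<^esub> ?h y" if "x \<in> carrier R" "y \<in> carrier R" for x y
    using that car by (subst add_RDirProd_list_map) (auto simp: mult_distrib)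
  moreover have "?h (x \<otimes> y) = ?h x \<otimes>\<^bsub>?P\<^esub> ?h y" if "x \<in> carrier R" "y \<in> carrier R" for x y
  proof -
    have "(x \<otimes> e) \<otimes> (y \<otimes> e) = x \<otimes> y \<otimes> e" if "e \<in> set es" for e
    proof -
      have "(x \<otimes> e) \<otimes> (y \<otimes> e) = x \<otimes> y \<otimes> (e \<otimes> e)"
        using \<open>x \<in> carrier R\<close> \<open>y \<in> carrier R\<close> car[OF that] by (simp add: mult_ac)
      then show ?thesis
        using idem[OF that] by simp
    qed
    then show ?thesis
      using that by (subst mult_RDirProd_list_map) auto
  qed
  ultimately show ?thesis
    unfolding pseudoring_isomorphic_def pseudoring_iso_def by blast
qed

end

section \<open>The identity element of a pseudomeadow\<close>

context pseudomeadow
begin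

lemma eq_zero_if_annihilated_by_minimal_idempotents:
  assumes "finite (idempotents M)" "z \<in> carrier M"
    and ann: "\<And>e. e \<in> minimal_idempotents M \<Longrightarrow> z \<otimes> e = \<zero>"
  shows "z = \<zero>"
proof (rule ccontr)
  assume "z \<noteq> \<zero>"
  obtain y where y: "y \<in> carrier M" "z \<otimes> z \<otimes> y = z"
    using von_Neumann_inverse assms(2) by blast
  let ?f = "z \<otimes> y"
  \<comment> \<open>Regrouped so that \<open>z \<otimes> z \<otimes> y = z\<close> collapses the
    square to \<open>?f\<close>.\<close>
  have "?f \<otimes> ?f = (z \<otimes> z \<otimes> y) \<otimes> y"
    using assms(2) y(1) by (simp add: mult_ac)
  then have idem: "?f \<in> idempotents M"
    using assms(2) y by (simp add: idempotents_def)
  \<comment> \<open>Hence \<open>?f = \<zero>\<close> would force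
    \<open>z = \<zero>\<close>.\<close>
  have "z \<otimes> ?f = z"
    using assms(2) y by (simp add: mult_assoc)
  then have "?f \<noteq> \<zero>"
    using \<open>z \<noteq> \<zero>\<close> assms(2) by auto
  then obtain e where e: "e \<in> minimal_idempotents M" "idem_le M e ?f"
    using ex_minimal_idempotent_le assms(1) idem by blast
  have eM: "e \<in> carrier M"
    using e(1) by (rule minimal_idempotentsD)
  have "e = e \<otimes> (z \<otimes> y)"
    using e(2) by (simp add: idem_le_def)
  also have "\<dots> = z \<otimes> e \<otimes> y"
    using eM assms(2) y(1) by (simp add: mult_ac)
  also have "\<dots> = \<zero>"
    using ann[OF e(1)] y(1) by simp
  finally show False
    using minimal_idempotentsD(3)[OF e(1)] by simp
qed

lemma is_mult_identity_finsum_minimal_idempotents: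
  assumes "finite (idempotents M)"
  shows "is_mult_identity M (\<Oplus>e\<in>minimal_idempotents M. e)"
proof -
  let ?u = "\<Oplus>e\<in>minimal_idempotents M. e"
  have fin: "finite (minimal_idempotents M)"
    using assms minimal_idempotents_subset by (rule rev_finite_subset)
  have uM: "?u \<in> carrier M"
    by (intro finsum_closed) (auto dest: minimal_idempotentsD)
  have ue: "?u \<otimes> e = e" if "e \<in> minimal_idempotents M" for e
  proof -
    have "?u \<otimes> e = e \<otimes> e"
      using that fin minimal_idempotents_orthogonal
      by (intro finsum_mult_orthogonal) (auto dest: minimal_idempotentsD)
    then show ?thesis
      using minimal_idempotentsD[OF that] by simp
  qed
  have ux: "?u \<otimes> x = x" if x: "x \<in> carrier M" for x
  proof -
    have "(x \<ominus> ?u \<otimes> x) \<otimes> e = \<zero>" if e: "e \<in> minimal_idempotents M" for e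
    proof -
      have eM: "e \<in> carrier M"
        using e by (rule minimal_idempotentsD)
      have "?u \<otimes> x \<otimes> e = (?u \<otimes> e) \<otimes> x"
        using uM x eM by (simp add: mult_ac)
      also have "\<dots> = x \<otimes> e"
        using ue[OF e] x eM by (simp add: mult_comm)
      finally show ?thesis
        \<comment> \<open>\<open>minus_mult\<close> needs the binary \<ominus>, so it is applied
          before \<open>a_minus_def\<close> unfolds it; the two equal products then cancel.\<close>
        using uM x eM by (simp add: minus_mult) (simp add: a_minus_def r_neg)
    qed
    with assms uM x have "x \<ominus> ?u \<otimes> x = \<zero>"
      using eq_zero_if_annihilated_by_minimal_idempotents[of "x \<ominus> ?u \<otimes> x"] by simp
    then show ?thesis
      \<comment> \<open>Uniqueness of negatives: \<open>x\<close> is the negative of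
        \<open>\<ominus> (?u \<otimes> x)\<close>, which is \<open>?u \<otimes> x\<close>.\<close>
      using uM x minus_equality[of x "\<ominus> (?u \<otimes> x)"] by (simp add: a_minus_def minus_minus)
  qed
  show ?thesis
    using uM ux mult_comm by (metis is_mult_identity_def)
qed

end

theorem corollary3p6:
  fixes M :: "('a, 'm) ring_scheme" (structure)
  assumes "pseudomeadow M"
    and "finite (idempotents M)"
  shows "(\<exists>u. is_mult_identity M u \<and> u = (\<Oplus>e \<in> minimal_idempotents M. e))
    \<and> (\<forall>es. distinct es \<and> set es = minimal_idempotents M \<longrightarrow>
          pseudoring_isomorphic M (RDirProd_list (map (corner M) es)))"
proof -
  interpret pseudomeadow M by fact
  have one: "is_mult_identity M (\<Oplus>e \<in> minimal_idempotents M. e)"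
    using assms(2) by (rule is_mult_identity_finsum_minimal_idempotents)
  have "pseudoring_isomorphic M (RDirProd_list (map (corner M) es))"
    if "distinct es" "set es = minimal_idempotents M" for es
    using that one minimal_idempotents_subset[of M] minimal_idempotents_orthogonal
    by (intro isomorphic_RDirProd_list_corner) simp_all
  with one show ?thesis by blast
qed

end
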